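(* Let $\mathcal{H}$ be a real Hilbert space, and let $A \in \mathcal{B}(\mathcal{H})$ be a positive self-adjoint operator. Assume that $\|A\|$ is a simple eigenvalue of $A$, and let $u_0 \in \ker(\|A\| I - A)$ be a unit vector. Additionally, suppose that $$\lambda_1 := \sup_{\substack{u \in (\ker(\|A\| I - A))^{\perp} \\ \|u\| = 1}} \langle u, Au \rangle < \|A\|.$$ Put $$\alpha := \frac{\lambda_1}{\|A\|}, \qquad r := \frac{1-\alpha^2}{4\sqrt{2}\,(1+\alpha^2)}.$$ Then, for any unit vector $u_1 \in \mathcal{H}$ with $\|u_1 - u_0\| < r$, the operator $A$ is positivity improving with respect to the cone $\mathcal{P}(u_1)$.
   Context: $\mathcal{B}(\mathcal{H})$ is the set of bounded linear operators on $\mathcal{H}$, and $I$ is the identity. Positive means $\langle u, Au\rangle \ge 0$ for all $u\in\mathcal{H}$. A simple eigenvalue is one whose eigenspace is one-dimensional. For a unit vector $w \in \mathcal{H}$, the cone with $w$ as its axis is $\mathcal{P}(w) := \{ u \in \mathcal{H} \mid \langle w, u\rangle \ge \|u\|/\sqrt{2}\}$; it is a Hilbert cone. Here a Hilbert cone in $\mathcal{H}$ is a non-empty subset $\mathcal{C}\subset\mathcal{H}$ such that: (i) $\mathcal{C}+\mathcal{C}\subset\mathcal{C}$, $[0,\infty)\cdot\mathcal{C}\subset\mathcal{C}$ and $\mathcal{C}\cap(-\mathcal{C})=\{0\}$; (ii) $\mathcal{C}$ is closed; (iii) $\langle u,v\rangle\ge 0$ for all $u,v\in\mathcal{C}$;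 (iv) for every $w\in\mathcal{H}$ there exist $u,v\in\mathcal{C}$ with $w=u-v$ and $\langle u,v\rangle=0$. For a Hilbert cone $\mathcal{C}$, the set of strictly positive vectors is $\mathcal{C}_{>0} := \{u\in\mathcal{C}\setminus\{0\} \mid \langle v,u\rangle>0 \text{ for all } v\in\mathcal{C}\setminus\{0\}\}$. An operator $A\in\mathcal{B}(\mathcal{H})$ is positivity improving with respect to $\mathcal{C}$ if $A(\mathcal{C}\setminus\{0\})\subset\mathcal{C}_{>0}$. *)

theory Defs
  imports "HOL-Analysis.Analysis"
begin

text \<open>
  A real Hilbert space of arbitrary dimension is a type of sort
  \<open>{real_inner, complete_space}\<close>; a bounded operator on it is a bounded linear function
  \<open>'a \<Rightarrow>\<^sub>L 'a\<close>, whose \<open>norm\<close> is the operator norm.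
\<close>

definition self_adjoint :: "('a::real_inner \<Rightarrow>\<^sub>L 'a) \<Rightarrow> bool" where
  "self_adjoint A \<longleftrightarrow> (\<forall>u v. inner (A u) v = inner u (A v))"

definition positive_operator :: "('a::real_inner \<Rightarrow>\<^sub>L 'a) \<Rightarrow> bool" where
  "positive_operator A \<longleftrightarrow> (\<forall>u. 0 \<le> inner u (A u))"

definition kernel :: "('a::real_normed_vector \<Rightarrow>\<^sub>L 'a) \<Rightarrow> 'a set" where
  "kernel T = {u. T u = 0}"

abbreviation eigenspace :: "('a::real_normed_vector \<Rightarrow>\<^sub>L 'a) \<Rightarrow> real \<Rightarrow> 'a set" where
  "eigenspace A c \<equiv> kernel (c *\<^sub>R id_blinfun - A)"

text \<open>
  \<open>dim\<close> is the cardinality of a basis, and is \<open>0\<close> on infinite-dimensional subspaces, so the value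
  \<open>1\<close> does say that the eigenspace is one-dimensional, in particular nonzero.
\<close>

definition simple_eigenvalue :: "('a::real_normed_vector \<Rightarrow>\<^sub>L 'a) \<Rightarrow> real \<Rightarrow> bool" where
  "simple_eigenvalue A c \<longleftrightarrow> dim (eigenspace A c) = 1"

text \<open>
  The supremum of \<open>\<langle>u, Au\<rangle>\<close> over the unit vectors of a subspace. It is used for positive operators
  only, so it is a supremum of values in \<open>[0,\<infinity>)\<close>; accordingly it is \<open>0\<close> when the subspace has no
  unit vector, where the supremum over the empty set of reals in HOL would be unspecified.
\<close>

definition rayleigh_sup :: "('a::real_inner \<Rightarrow>\<^sub>L 'a) \<Rightarrow> 'a set \<Rightarrow> real" where
  "rayleigh_sup A V =
     (if {u \<in> V. norm u = 1} = {} then 0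
      else (SUP u \<in> {u \<in> V. norm u = 1}. inner u (A u)))"


definition hilbert_cone :: "'a::real_inner set \<Rightarrow> bool" where
  "hilbert_cone C \<longleftrightarrow>
     C \<noteq> {} \<and>
     (\<forall>u\<in>C. \<forall>v\<in>C. u + v \<in> C) \<and>
     (\<forall>t\<ge>0. \<forall>u\<in>C. t *\<^sub>R u \<in> C) \<and>
     C \<inter> uminus ` C = {0} \<and>
     closed C \<and>
     (\<forall>u\<in>C. \<forall>v\<in>C. 0 \<le> inner u v) \<and>
     (\<forall>w. \<exists>u\<in>C. \<exists>v\<in>C. w = u - v \<and> inner u v = 0)"

definition strictly_positive :: "'a::real_inner set \<Rightarrow> 'a set" where
  "strictly_positive C = {u \<in> C - {0}. \<forall>v \<in> C - {0}. 0 < inner v u}"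

definition positivity_improving :: "('a::real_inner \<Rightarrow>\<^sub>L 'a) \<Rightarrow> 'a set \<Rightarrow> bool" where
  "positivity_improving A C \<longleftrightarrow> blinfun_apply A ` (C - {0}) \<subseteq> strictly_positive C"

definition axis_cone :: "'a::real_inner \<Rightarrow> 'a set" where
  "axis_cone w = {u. norm u / sqrt 2 \<le> inner w u}"

lemma axis_cone_iff:
  fixes w :: "'a::real_inner"
  assumes w: "norm w = 1"
  shows "u \<in> axis_cone w \<longleftrightarrow> norm (u - inner w u *\<^sub>R w) \<le> inner w u"
proof -
  let ?a = "inner w u" and ?x = "u - inner w u *\<^sub>R w"
  have ww: "inner w w = 1" using w by (simp add: norm_eq_1)
  have pyth: "(norm u)\<^sup>2 = ?a\<^sup>2 + (norm ?x)\<^sup>2"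
    unfolding power2_norm_eq_inner
    by (simp add: inner_diff_left inner_diff_right ww inner_commute power2_eq_square)
  have "u \<in> axis_cone w \<longleftrightarrow> norm u \<le> sqrt 2 * ?a"
    by (simp add: axis_cone_def divide_le_eq mult.commute)
  also have "\<dots> \<longleftrightarrow> 0 \<le> ?a \<and> (norm u)\<^sup>2 \<le> (sqrt 2 * ?a)\<^sup>2"
    by (smt (verit) norm_ge_zero power2_le_imp_le power_mono real_sqrt_gt_zero
        zero_le_mult_iff)
  also have "\<dots> \<longleftrightarrow> 0 \<le> ?a \<and> (norm ?x)\<^sup>2 \<le> ?a\<^sup>2"
    by (simp add: pyth power_mult_distrib)
  also have "\<dots> \<longleftrightarrow> norm ?x \<le> ?a"
    by (smt (verit) norm_ge_zero power2_le_imp_le power_mono)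
  finally show ?thesis .
qed

lemma hilbert_cone_axis_cone:
  fixes w :: "'a::real_inner"
  assumes w: "norm w = 1"
  shows "hilbert_cone (axis_cone w)"
proof -
  note iff = axis_cone_iff[OF w]
  have ww: "inner w w = 1" using w by (simp add: norm_eq_1)
  have zero: "0 \<in> axis_cone w" by (simp add: axis_cone_def)
  have add: "u + v \<in> axis_cone w" if "u \<in> axis_cone w" "v \<in> axis_cone w" for u v
  proof -
    have "norm (u + v) / sqrt 2 \<le> (norm u + norm v) / sqrt 2"
      by (intro divide_right_mono norm_triangle_ineq) simp
    then show ?thesis using that by (simp add: axis_cone_def add_divide_distrib inner_add_right)
  qed
  have scale: "t *\<^sub>R u \<in> axis_cone w" if "0 \<le> t" "u \<in> axis_cone w" for t u
    using that mult_left_mono[of "norm u / sqrt 2" "inner w u" t] by (simp add: axis_cone_def)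
  have pointed: "u = 0" if "u \<in> axis_cone w" "- u \<in> axis_cone w" for u
  proof -
    have "norm u / sqrt 2 \<le> 0" using that by (simp add: axis_cone_def)
    then show ?thesis by (simp add: divide_le_0_iff)
  qed
  have closed: "closed (axis_cone w)"
    unfolding axis_cone_def by (intro closed_Collect_le continuous_intros) auto
  have nonneg: "0 \<le> inner u v" if "u \<in> axis_cone w" "v \<in> axis_cone w" for u v
  proof -
    let ?a = "inner w u" and ?b = "inner w v"
    let ?x = "u - ?a *\<^sub>R w" and ?y = "v - ?b *\<^sub>R w"
    have x: "norm ?x \<le> ?a" and y: "norm ?y \<le> ?b" using that by (simp_all add: iff)
    have "inner u v = ?a * ?b + inner ?x ?y"
      by (simp add: inner_diff_left inner_diff_right ww inner_commute)
    moreover have "- (norm ?x * norm ?y) \<le> inner ?x ?y"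
      using Cauchy_Schwarz_ineq2[of ?x ?y] by linarith
    moreover have "norm ?x * norm ?y \<le> ?a * ?b"
      using x y norm_ge_zero[of ?x] by (intro mult_mono) (auto intro: order_trans[OF norm_ge_zero])
    ultimately show ?thesis by linarith
  qed
  have decomp: "\<exists>u\<in>axis_cone w. \<exists>v\<in>axis_cone w. z = u - v \<and> inner u v = 0" for z
  proof -
    define a where "a = inner w z"
    define p where "p = z - a *\<^sub>R w"
    have wp: "inner w p = 0" by (simp add: p_def a_def inner_diff_right ww)
    consider "norm p \<le> a" | "norm p \<le> - a" | "\<bar>a\<bar> < norm p" by linarith
    then show ?thesis
    proof cases
      case 1
      then have "z \<in> axis_cone w" by (simp add: iff p_def a_def)
      with zero show ?thesis by (intro bexI[of _ z] bexI[of _ 0]) auto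
    next
      case 2
      have "- z \<in> axis_cone w"
        using 2 norm_minus_cancel[of p] by (simp add: iff p_def a_def add.commute)
      with zero show ?thesis by (intro bexI[of _ 0] bexI[of _ "- z"]) auto
    next
      case 3
      define q where "q = p /\<^sub>R norm p"
      have n: "norm p > 0" using 3 by linarith
      have nq: "norm q = 1" using n by (simp add: q_def)
      have wq: "inner w q = 0" by (simp add: q_def wp)
      have qq: "inner q q = 1" using nq by (simp add: norm_eq_1)
      have pq: "p = norm p *\<^sub>R q" using n by (simp add: q_def)
      define u where "u = ((norm p + a) / 2) *\<^sub>R (w + q)"
      define v where "v = ((norm p - a) / 2) *\<^sub>R (w - q)"
      have "w + q \<in> axis_cone w" "w - q \<in> axis_cone w"
        by (simp_all add: iff inner_add_right inner_diff_right ww wq nq)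
      then have "u \<in> axis_cone w" "v \<in> axis_cone w"
        using 3 by (auto simp: u_def v_def intro!: scale)
      moreover have "inner u v = 0"
        by (simp add: u_def v_def inner_add_left inner_diff_right ww wq qq inner_commute[of q w])
      moreover have "z = u - v"
      proof -
        have "u - v = ((norm p + a) / 2 - (norm p - a) / 2) *\<^sub>R w
            + ((norm p + a) / 2 + (norm p - a) / 2) *\<^sub>R q"
          unfolding u_def v_def
          by (simp only: scaleR_add_right scaleR_diff_right scaleR_add_left scaleR_diff_left) simp
        also have "\<dots> = a *\<^sub>R w + norm p *\<^sub>R q" by (simp add: field_simps)
        also have "\<dots> = z" using pq by (simp add: p_def)
        finally show ?thesis by simp
      qed
      ultimately show ?thesis by blast
    qed
  qed
  have "axis_cone w \<inter> uminus ` axis_cone w = {0}"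
    using zero pointed by (force simp: image_iff)
  with zero add scale closed nonneg decomp show ?thesis
    unfolding hilbert_cone_def by blast
qed

end

theory Submission
  imports Defs
begin

text \<open>
  Split a vector as \<open>u = c u0 + y\<close> with \<open>y\<close> orthogonal to \<open>u0\<close>. Since the top eigenspace is the
  line through \<open>u0\<close>, the operator acts on the two parts separately, and
  \<open>\<langle>v, Au\<rangle> = \<parallel>A\<parallel> c' c + \<langle>x, Ay\<rangle>\<close> for \<open>v = c' u0 + x\<close>. The Cauchy-Schwarz inequality for the
  positive semidefinite form \<open>\<langle>x, Ay\<rangle>\<close> bounds the last term by \<open>\<lambda>\<^sub>1 \<parallel>x\<parallel> \<parallel>y\<parallel>\<close>. Hence \<open>\<langle>v, Au\<rangle> > 0\<close>
  as soon as both vectors lie in the open cone \<open>\<surd>\<alpha> \<parallel>y\<parallel> < c\<close> around \<open>u0\<close>, which is wider than the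
  cone \<open>\<parallel>y\<parallel> \<le> c\<close> because \<open>\<alpha> < 1\<close> (lemma \<open>inner_apply_pos_of_wide_cone\<close>).

  The extra width leaves room to tilt the axis. A unit vector of the cone with axis \<open>u1\<close> satisfies
  \<open>\<langle>u0, u\<rangle> \<ge> 1/\<surd>2 - \<parallel>u1 - u0\<parallel>\<close>, while a unit vector is in the wide cone iff \<open>\<langle>u0, u\<rangle>\<close> exceeds
  \<open>\<surd>(\<alpha>/(1+\<alpha>))\<close>; the radius \<open>r\<close> is small enough for the first to imply the second (lemma
  \<open>wide_cone_of_tilted_cone\<close>). Finally, a Hilbert cone is self-dual, so positivity of all
  \<open>\<langle>v, Au\<rangle>\<close> already puts \<open>Au\<close> into the cone (lemma \<open>positivity_improvingI\<close>).
\<close>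

section \<open>Self-duality of Hilbert cones\<close>

text \<open>
  Decompose \<open>A u = p - q\<close> with orthogonal \<open>p\<close> and \<open>q\<close> in the cone; then
  \<open>\<langle>q, A u\<rangle> = - \<parallel>q\<parallel>\<^sup>2\<close>, which the hypothesis forbids unless \<open>q = 0\<close>.
\<close>
lemma positivity_improvingI:
  assumes C: "hilbert_cone C"
    and pos: "\<And>u v. u \<in> C - {0} \<Longrightarrow> v \<in> C - {0} \<Longrightarrow> 0 < inner v (blinfun_apply A u)"
  shows "positivity_improving A C"
  unfolding positivity_improving_def
proof (rule image_subsetI)
  fix u assume u: "u \<in> C - {0}"
  obtain p q where pq: "p \<in> C" "q \<in> C" "A u = p - q" "inner p q = 0"
    using C unfolding hilbert_cone_def by meson
  have "inner q (A u) = - inner q q"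
    using pq by (simp add: inner_diff_right inner_commute)
  then have "q = 0"
    using pos[OF u, of q] pq(2) inner_ge_zero[of q] by fastforce
  then have "A u \<in> C" using pq by simp
  moreover have "A u \<noteq> 0" using pos[OF u u] by auto
  ultimately show "A u \<in> strictly_positive C"
    using pos[OF u] by (simp add: strictly_positive_def)
qed

section \<open>Positive operators and their Rayleigh quotients\<close>

text \<open>
  The value of the form at \<open>x - t y\<close> is a nonnegative quadratic polynomial in \<open>t\<close>. Its minimum, at
  \<open>t = \<langle>x, Ay\<rangle> / \<langle>y, Ay\<rangle>\<close>, gives the bound; if \<open>\<langle>y, Ay\<rangle> = 0\<close>, the polynomial is affine and
  therefore constant.
\<close>
lemma positive_operator_Cauchy_Schwarz:
  assumes sa: "self_adjoint A" and pos: "positive_operator A"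
  shows "(inner x (blinfun_apply A y))\<^sup>2 \<le> inner x (A x) * inner y (A y)"
proof -
  define p b c where "p = inner x (A x)" and "b = inner x (A y)" and "c = inner y (A y)"
  have sym: "inner y (A x) = b"
    using sa unfolding self_adjoint_def b_def by (metis inner_commute)
  have quad: "0 \<le> p - 2 * t * b + t\<^sup>2 * c" for t
  proof -
    have "inner (x - t *\<^sub>R y) (A (x - t *\<^sub>R y)) = p - 2 * t * b + t\<^sup>2 * c"
      by (simp add: blinfun.diff_right blinfun.scaleR_right inner_diff_left inner_diff_right
          sym p_def[symmetric] b_def[symmetric] c_def[symmetric] power2_eq_square algebra_simps)
    then show ?thesis using pos by (metis positive_operator_def)
  qed
  have "0 \<le> c" using pos by (simp add: c_def positive_operator_def)
  have "b\<^sup>2 \<le> p * c"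
  proof (cases "c = 0")
    case True
    have "b = 0"
    proof (rule ccontr)
      assume "b \<noteq> 0"
      \<comment> \<open>at this \<open>t\<close> the affine polynomial takes the value \<open>-1\<close>\<close>
      then show False using quad[of "(p + 1) / (2 * b)"] True by simp
    qed
    then show ?thesis using True by simp
  next
    case False
    then show ?thesis using quad[of "b / c"] \<open>0 \<le> c\<close>
      by (simp add: field_simps power2_eq_square)
  qed
  then show ?thesis by (simp add: p_def b_def c_def)
qed

lemma bdd_above_rayleigh:
  "bdd_above ((\<lambda>u. inner u (blinfun_apply A u)) ` {u \<in> V. norm u = 1})"
proof (rule bdd_aboveI2)
  fix u assume u: "u \<in> {u \<in> V. norm u = 1}"
  then show "inner u (A u) \<le> norm A"
    using norm_cauchy_schwarz[of u "A u"] norm_blinfun[of A u] by simp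
qed

lemma rayleigh_sup_upper:
  assumes "e \<in> V" "norm e = 1"
  shows "inner e (blinfun_apply A e) \<le> rayleigh_sup A V"
proof -
  have e: "e \<in> {u \<in> V. norm u = 1}" using assms by simp
  then have "{u \<in> V. norm u = 1} \<noteq> {}" by blast
  then show ?thesis
    using cSUP_upper[OF e bdd_above_rayleigh[of A V]] by (simp only: rayleigh_sup_def if_False)
qed

lemma inner_apply_le_rayleigh_sup:
  assumes V: "subspace V" and y: "y \<in> V"
  shows "inner y (blinfun_apply A y) \<le> rayleigh_sup A V * (norm y)\<^sup>2"
proof (cases "y = 0")
  case False
  define e where "e = y /\<^sub>R norm y"
  have "inner e (A e) \<le> rayleigh_sup A V"
    using V y False by (intro rayleigh_sup_upper) (simp_all add: e_def subspace_scale)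
  moreover have "y = norm y *\<^sub>R e" using False by (simp add: e_def)
  then have "inner y (A y) = inner e (A e) * (norm y)\<^sup>2"
    by (metis (no_types, lifting) blinfun.scaleR_right inner_scaleR_left inner_scaleR_right
        mult.assoc mult.commute power2_eq_square)
  ultimately show ?thesis by (simp add: mult_right_mono)
qed simp

lemma rayleigh_sup_nonneg:
  assumes "positive_operator A"
  shows "0 \<le> rayleigh_sup A V"
proof (cases "{u \<in> V. norm u = 1} = {}")
  case False
  then obtain e where e: "e \<in> V" "norm e = 1" by blast
  have "0 \<le> inner e (A e)" using assms by (simp add: positive_operator_def)
  also have "\<dots> \<le> rayleigh_sup A V"
    using e by (rule rayleigh_sup_upper)
  finally show ?thesis .
next
  case True
  then show ?thesis by (simp add: rayleigh_sup_def)
qed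

text \<open>
  For the top eigenspace this means that a vector orthogonal to \<open>u0\<close> alone is already orthogonal
  to the whole eigenspace, so that the supremum \<open>\<lambda>\<^sub>1\<close> controls it.
\<close>
lemma mem_span_of_dim_1:
  fixes V :: "'a::real_vector set"
  assumes dim: "dim V = 1" and e: "e \<in> V" "e \<noteq> 0" and x: "x \<in> V"
  shows "x \<in> span {e}"
proof -
  obtain B where B: "V \<subseteq> span B" "card B = 1"
    using basis_exists[of V] dim by metis
  then obtain b where b: "V \<subseteq> span {b}" by (auto simp: card_1_singleton_iff)
  obtain k where k: "e = k *\<^sub>R b" using b e by (auto simp: span_singleton)
  obtain l where l: "x = l *\<^sub>R b" using b x by (auto simp: span_singleton)
  have "k \<noteq> 0" using k e by auto
  then have "x = (l / k) *\<^sub>R e" using k l by simp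
  then show ?thesis by (auto simp: span_singleton)
qed

section \<open>Positivity on a wide cone around the eigenvector\<close>

text \<open>
  On the complement of \<open>e\<close> the form is at most \<open>\<alpha> N\<close> times the squared norm, so by Cauchy-Schwarz
  its off-diagonal value at the two orthogonal parts is at most \<open>N\<close> times the product of their norms
  scaled by \<open>\<surd>\<alpha>\<close>. Membership in the wide cone makes these scaled norms smaller than the components
  along \<open>e\<close>, whose product times \<open>N\<close> is the leading term.
\<close>
lemma inner_apply_pos_of_wide_cone:
  fixes A :: "'a::real_inner \<Rightarrow>\<^sub>L 'a"
  assumes sa: "self_adjoint A" and pos: "positive_operator A"
    and Ae: "A e = N *\<^sub>R e" and ne: "norm e = 1" and N: "0 < N" and \<alpha>: "0 \<le> \<alpha>"
    and bound: "\<And>y. inner e y = 0 \<Longrightarrow> inner y (A y) \<le> \<alpha> * N * (norm y)\<^sup>2"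
    and u: "0 < inner e u" "\<alpha> * (norm (u - inner e u *\<^sub>R e))\<^sup>2 < (inner e u)\<^sup>2"
    and v: "0 < inner e v" "\<alpha> * (norm (v - inner e v *\<^sub>R e))\<^sup>2 < (inner e v)\<^sup>2"
  shows "0 < inner v (A u)"
proof -
  have ee: "inner e e = 1" using ne by (simp add: norm_eq_1)
  define c d where "c = inner e u" and "d = inner e v"
  define y x where "y = u - c *\<^sub>R e" and "x = v - d *\<^sub>R e"
  have ortho: "inner e y = 0" "inner e x = 0"
    by (simp_all add: y_def x_def c_def d_def inner_diff_right ee)
  have "inner e (A y) = N * inner e y"
    using sa Ae unfolding self_adjoint_def by (metis inner_scaleR_left)
  then have eAy: "inner e (A y) = 0" using ortho by simp
  have u_eq: "u = c *\<^sub>R e + y" and v_eq: "v = d *\<^sub>R e + x" by (simp_all add: y_def x_def)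
  have split: "inner v (A u) = N * (d * c) + inner x (A y)"
    unfolding u_eq v_eq using ortho eAy
    by (simp add: blinfun.add_right blinfun.scaleR_right Ae inner_add_left inner_add_right ee
        inner_commute[of x e])
  have "(inner x (A y))\<^sup>2 \<le> inner x (A x) * inner y (A y)"
    by (rule positive_operator_Cauchy_Schwarz[OF sa pos])
  also have "\<dots> \<le> (\<alpha> * N * (norm x)\<^sup>2) * (\<alpha> * N * (norm y)\<^sup>2)"
    using bound ortho pos \<alpha> N by (intro mult_mono) (auto simp: positive_operator_def)
  also have "\<dots> = N\<^sup>2 * ((\<alpha> * (norm x)\<^sup>2) * (\<alpha> * (norm y)\<^sup>2))"
    by (simp add: power2_eq_square)
  also have "\<dots> < N\<^sup>2 * (d\<^sup>2 * c\<^sup>2)"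
    using u v \<alpha> N unfolding y_def x_def c_def d_def
    by (intro mult_strict_left_mono mult_strict_mono') auto
  also have "\<dots> = (N * (d * c))\<^sup>2" by (simp add: power_mult_distrib)
  finally have sq: "\<bar>inner x (A y)\<bar>\<^sup>2 < (N * (d * c))\<^sup>2" by simp
  have "0 \<le> N * (d * c)" using N u(1) v(1) by (simp add: c_def d_def)
  then have "\<bar>inner x (A y)\<bar> < N * (d * c)" by (rule power2_less_imp_less[OF sq])
  then show ?thesis using split by linarith
qed

section \<open>Tilting the axis\<close>

text \<open>
  With \<open>c\<close> the component of a unit vector along \<open>u0\<close>, this compares the loss by tilting with the
  opening of the wide cone, which is the condition \<open>c\<^sup>2 > \<alpha>/(1+\<alpha>)\<close>. Expanding the square gives \<open>c\<^sup>2 > 1/2 - (1-\<alpha>\<^sup>2) / (4(1+\<alpha>\<^sup>2))\<close>, and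
  \<open>\<alpha>/(1+\<alpha>) = 1/2 - (1-\<alpha>) / (2(1+\<alpha>))\<close>; the two are comparable because
  \<open>(1+\<alpha>)\<^sup>2 \<le> 2(1+\<alpha>\<^sup>2)\<close>.
\<close>
lemma tilt_radius_bound:
  fixes \<alpha> c :: real
  assumes \<alpha>: "0 \<le> \<alpha>" "\<alpha> < 1"
    and c: "1 / sqrt 2 - (1 - \<alpha>\<^sup>2) / (4 * sqrt 2 * (1 + \<alpha>\<^sup>2)) < c"
  shows "0 < c" and "\<alpha> * (1 - c\<^sup>2) < c\<^sup>2"
proof -
  define s where "s = (1 - \<alpha>\<^sup>2) / (4 * (1 + \<alpha>\<^sup>2))"
  have den: "0 < 1 + \<alpha>\<^sup>2" by (simp add: add_pos_nonneg)
  have "\<alpha>\<^sup>2 \<ge> 0" by simp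
  then have s1: "s \<le> 1/4" unfolding s_def using den by (simp add: divide_le_eq)
  have eq: "1 / sqrt 2 - (1 - \<alpha>\<^sup>2) / (4 * sqrt 2 * (1 + \<alpha>\<^sup>2)) = (1 - s) / sqrt 2"
    unfolding s_def by (simp only: diff_divide_distrib divide_divide_eq_left mult_ac)
  have pos: "0 < (1 - s) / sqrt 2" using s1 by simp
  then show "0 < c" using c eq by linarith
  have "((1 - s) / sqrt 2)\<^sup>2 < c\<^sup>2"
    using c eq pos by (intro power_strict_mono) auto
  then have c2: "(1 - s)\<^sup>2 / 2 < c\<^sup>2" by (simp add: power_divide)
  have "(1 - s)\<^sup>2 = 1 - 2 * s + s\<^sup>2" by (simp add: power2_eq_square algebra_simps)
  then have "1/2 - s < c\<^sup>2" using c2 zero_le_power2[of s] by linarith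
  then have strict: "(1/2 - s) * (1 + \<alpha>) < c\<^sup>2 * (1 + \<alpha>)"
    using \<alpha> by (intro mult_strict_right_mono) auto
  have "s * (1 + \<alpha>) \<le> (1 - \<alpha>) / 2"
  proof -
    have "(1 + \<alpha>)\<^sup>2 \<le> 2 * (1 + \<alpha>\<^sup>2)"
      using zero_le_power2[of "1 - \<alpha>"] by (simp add: power2_eq_square algebra_simps)
    then have "(1 - \<alpha>) * (1 + \<alpha>)\<^sup>2 \<le> (1 - \<alpha>) * (2 * (1 + \<alpha>\<^sup>2))"
      using \<alpha> by (intro mult_left_mono) auto
    moreover have "(1 - \<alpha>\<^sup>2) * (1 + \<alpha>) = (1 - \<alpha>) * (1 + \<alpha>)\<^sup>2"
      by (simp add: power2_eq_square algebra_simps)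
    moreover have "(1 - \<alpha>) * (2 * (1 + \<alpha>\<^sup>2)) = (1 - \<alpha>) / 2 * (4 * (1 + \<alpha>\<^sup>2))"
      by (simp add: field_simps)
    ultimately have "(1 - \<alpha>\<^sup>2) * (1 + \<alpha>) \<le> (1 - \<alpha>) / 2 * (4 * (1 + \<alpha>\<^sup>2))"
      by (simp only:)
    then show ?thesis unfolding s_def using den by (simp add: pos_divide_le_eq)
  qed
  moreover have "(1/2 - s) * (1 + \<alpha>) = (1 + \<alpha>) / 2 - s * (1 + \<alpha>)"
    by (simp add: algebra_simps)
  ultimately have "\<alpha> < c\<^sup>2 * (1 + \<alpha>)" using strict by (simp add: field_simps)
  then show "\<alpha> * (1 - c\<^sup>2) < c\<^sup>2" by (simp add: algebra_simps)
qed

text \<open>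
  Moving the axis from \<open>w\<close> to \<open>e\<close> changes the component of a unit vector along it by at most
  \<open>\<parallel>w - e\<parallel>\<close>. Both conclusions are homogeneous in \<open>u\<close>, so the bound for unit vectors suffices.
\<close>
lemma wide_cone_of_tilted_cone:
  fixes e w u :: "'a::real_inner"
  assumes \<alpha>: "0 \<le> \<alpha>" "\<alpha> < 1" and ne: "norm e = 1"
    and tilt: "norm (w - e) < (1 - \<alpha>\<^sup>2) / (4 * sqrt 2 * (1 + \<alpha>\<^sup>2))"
    and u: "u \<in> axis_cone w" "u \<noteq> 0"
  shows "0 < inner e u" and "\<alpha> * (norm (u - inner e u *\<^sub>R e))\<^sup>2 < (inner e u)\<^sup>2"
proof -
  have n: "0 < norm u" using u by simp
  have ee: "inner e e = 1" using ne by (simp add: norm_eq_1)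
  define c where "c = inner e u / norm u"
  have eu: "inner e u = c * norm u" using n by (simp add: c_def)
  have "norm u / sqrt 2 \<le> inner w u" using u by (simp add: axis_cone_def)
  moreover have "inner (w - e) u \<le> norm (w - e) * norm u" by (rule norm_cauchy_schwarz)
  ultimately have "(1 / sqrt 2 - norm (w - e)) * norm u \<le> inner e u"
    by (simp add: inner_diff_left algebra_simps)
  then have "1 / sqrt 2 - norm (w - e) \<le> c" using n by (simp add: c_def pos_le_divide_eq)
  then have c: "1 / sqrt 2 - (1 - \<alpha>\<^sup>2) / (4 * sqrt 2 * (1 + \<alpha>\<^sup>2)) < c" using tilt by linarith
  note bounds = tilt_radius_bound[OF \<alpha> c]
  show "0 < inner e u" using bounds(1) n by (simp add: eu)
  have "(norm (u - inner e u *\<^sub>R e))\<^sup>2 = (norm u)\<^sup>2 - (inner e u)\<^sup>2"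
    unfolding power2_norm_eq_inner
    by (simp add: inner_diff_left inner_diff_right ee inner_commute power2_eq_square)
  also have "\<dots> = (1 - c\<^sup>2) * (norm u)\<^sup>2"
    by (simp add: eu power_mult_distrib algebra_simps)
  finally show "\<alpha> * (norm (u - inner e u *\<^sub>R e))\<^sup>2 < (inner e u)\<^sup>2"
    using mult_strict_right_mono[OF bounds(2), of "(norm u)\<^sup>2"] n
    by (simp add: eu power_mult_distrib)
qed

section \<open>Operators improving positivity\<close>

theorem theorem3p8:
  fixes A :: "'a::{real_inner, complete_space} \<Rightarrow>\<^sub>L 'a"
    and u0 u1 :: 'a
    and lambda1 \<alpha> r :: real
  assumes "self_adjoint A"
    and "positive_operator A"
    and "simple_eigenvalue A (norm A)"
    and "u0 \<in> kernel (norm A *\<^sub>R id_blinfun - A)"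
    and "norm u0 = 1"
    and "lambda1 = rayleigh_sup A ((kernel (norm A *\<^sub>R id_blinfun - A))\<^sup>\<bottom>)"
    and "lambda1 < norm A"
    and "\<alpha> = lambda1 / norm A"
    and "r = (1 - \<alpha>\<^sup>2) / (4 * sqrt 2 * (1 + \<alpha>\<^sup>2))"
    and "norm u1 = 1"
    and "norm (u1 - u0) < r"
  shows "positivity_improving A (axis_cone u1)"
proof (rule positivity_improvingI)
  show "hilbert_cone (axis_cone u1)" using assms by (intro hilbert_cone_axis_cone)
next
  fix u v assume u: "u \<in> axis_cone u1 - {0}" and v: "v \<in> axis_cone u1 - {0}"
  let ?E = "kernel (norm A *\<^sub>R id_blinfun - A)"
  have l0: "0 \<le> lambda1" using assms rayleigh_sup_nonneg by blast
  then have N: "0 < norm A" using assms(7) by linarith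
  have \<alpha>: "0 \<le> \<alpha>" "\<alpha> < 1" using l0 N assms(7,8) by auto
  have tilt: "norm (u1 - u0) < (1 - \<alpha>\<^sup>2) / (4 * sqrt 2 * (1 + \<alpha>\<^sup>2))" using assms by simp
  have Ae: "A u0 = norm A *\<^sub>R u0"
    using assms(4) by (simp add: kernel_def blinfun.diff_left blinfun.scaleR_left)
  have bound: "inner y (A y) \<le> \<alpha> * norm A * (norm y)\<^sup>2" if y: "inner u0 y = 0" for y
  proof -
    have "inner x y = 0" if "x \<in> ?E" for x
    proof -
      have "u0 \<noteq> 0" using assms(5) by auto
      then have "x \<in> span {u0}"
        using mem_span_of_dim_1 assms(3,4) that unfolding simple_eigenvalue_def by blast
      then show ?thesis using y by (auto simp: span_singleton)
    qed
    then have "y \<in> ?E\<^sup>\<bottom>" by (simp add: orthogonal_comp_def orthogonal_def)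
    then have "inner y (A y) \<le> lambda1 * (norm y)\<^sup>2"
      unfolding assms(6) by (intro inner_apply_le_rayleigh_sup subspace_orthogonal_comp)
    then show ?thesis using assms(8) N by simp
  qed
  have wide: "0 < inner u0 z \<and> \<alpha> * (norm (z - inner u0 z *\<^sub>R u0))\<^sup>2 < (inner u0 z)\<^sup>2"
    if "z \<in> axis_cone u1 - {0}" for z
    using wide_cone_of_tilted_cone[OF \<alpha> assms(5) tilt] that by blast
  show "0 < inner v (A u)"
    using inner_apply_pos_of_wide_cone[OF assms(1,2) Ae assms(5) N \<alpha>(1) bound] wide[OF u] wide[OF v]
    by blast
qed

end
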